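(* Let $L=\{0,+,-\}$ be the three-element monoid with identity $0$ and two left zeroes $+,-$, and let $ZL$ be the four-element monoid obtained by adjoining a multiplicative zero to $L$. A left regular band $S$ belongs to the quasivariety $\mathrm{qv}(ZL)$ if and only if it satisfies the following condition (CC'): for all $a,b\in S$ with $a\mathrel{\mathscr L}b$, if $a$ and $b$ are in the same connected component of the poset $S'_{a,b}=\{s\in S\mid sa=sb \text{ and } a\in Ss\}$, then $a=b$.
   Context: A left regular band is a semigroup (not necessarily finite) satisfying the identities $x^2=x$ and $xyx=xy$. In $L$, the element $0$ is the identity and $xy=x$ for all $x\in\{+,-\}$ and $y\in L$; $ZL$ has an additional element $z$ with $zx=xz=z$ for all $x$. For a finite semigroup $T$, the quasivariety $\mathrm{qv}(T)$ generated by $T$ consists of all semigroups isomorphic to a subsemigroup of a (possibly infinite) direct power of $T$. For elements $a,b$ of a left regular band $S$, $a\mathrel{\mathscr L}b$ means $Sa=Sb$, equivalently $ab=a$ and $ba=b$. Every left regular band is a poset under $x\leq y\iff yx=x$; if $a\mathrel{\mathscr L}b$, the subsemigroup $S'_{a,b}$ contains $a$ and $b$ and is given the restriction of this order. The connected components of a poset are the classes of the equivalence relation generated by $\leq$; thus $a,b$ are in the same component of $S'_{a,b}$ iff there is a zig-zag $a=a_0\leq a_1\geq a_2\leq\cdots\geq a_n=b$ with all $a_i\in S'_{a,b}$. *)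

theory Defs
  imports "HOL-Algebra.Product_Groups"
begin

section \<open>Semigroups and left regular bands\<close>

text \<open>A semigroup is a record of type \<open>monoid_scheme\<close>, so that \<open>hom\<close>, \<open>\<cong>\<close>,
  \<open>product_group\<close> and \<open>#>\<close> can be used; its field \<open>\<one>\<close> is never referred to.
  The carrier may be infinite, and may be empty.\<close>

locale semigroup_struct =
  fixes S :: "('a, 'm) monoid_scheme" (structure)
  assumes mult_closed: "\<lbrakk>x \<in> carrier S; y \<in> carrier S\<rbrakk> \<Longrightarrow> x \<otimes> y \<in> carrier S"
    and mult_assoc: "\<lbrakk>x \<in> carrier S; y \<in> carrier S; z \<in> carrier S\<rbrakk>
      \<Longrightarrow> (x \<otimes> y) \<otimes> z = x \<otimes> (y \<otimes> z)"

locale left_regular_band = semigroup_struct +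
  assumes idem: "x \<in> carrier S \<Longrightarrow> x \<otimes> x = x"
    and left_regular: "\<lbrakk>x \<in> carrier S; y \<in> carrier S\<rbrakk> \<Longrightarrow> x \<otimes> y \<otimes> x = x \<otimes> y"

definition subsemigroup :: "'a set \<Rightarrow> ('a, 'm) monoid_scheme \<Rightarrow> bool" where
  "subsemigroup H G \<longleftrightarrow>
    H \<subseteq> carrier G \<and> (\<forall>x\<in>H. \<forall>y\<in>H. x \<otimes>\<^bsub>G\<^esub> y \<in> H)"

section \<open>The monoids \<open>L\<close> and \<open>ZL\<close>\<close>

datatype L_elem = L_id | L_plus | L_minus

fun L_mult :: "L_elem \<Rightarrow> L_elem \<Rightarrow> L_elem" where
  "L_mult L_id y = y"
| "L_mult L_plus y = L_plus"
| "L_mult L_minus y = L_minus"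

definition L_monoid :: "L_elem monoid" where
  "L_monoid = \<lparr>carrier = UNIV, mult = L_mult, one = L_id\<rparr>"

text \<open>The new zero element is \<open>None\<close>.\<close>

definition adjoin_zero :: "('a, 'm) monoid_scheme \<Rightarrow> 'a option monoid" where
  "adjoin_zero M =
    \<lparr>carrier = insert None (Some ` carrier M),
     mult = (\<lambda>x y. case (x, y) of (Some u, Some v) \<Rightarrow> Some (u \<otimes>\<^bsub>M\<^esub> v) | _ \<Rightarrow> None),
     one = Some \<one>\<^bsub>M\<^esub>\<rparr>"

definition ZL :: "L_elem option monoid" where
  "ZL = adjoin_zero L_monoid"

section \<open>The quasivariety generated by a finite semigroup\<close>

definition direct_power :: "('b, 'n) monoid_scheme \<Rightarrow> 'i set \<Rightarrow> ('i \<Rightarrow> 'b) monoid" where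
  "direct_power T I = product_group I (\<lambda>_. T)"

text \<open>HOL cannot quantify over the type of the indices, so the index sets range over sets of
  maps from \<open>S\<close> to \<open>T\<close>. This is no restriction: by \<open>in_qvI\<close> below, an embedding into a
  direct power over an index set of any type yields one of this form.\<close>

definition in_qv :: "('b, 'n) monoid_scheme \<Rightarrow> ('a, 'm) monoid_scheme \<Rightarrow> bool" where
  "in_qv T S \<longleftrightarrow> semigroup_struct S \<and>
    (\<exists>(I :: ('a \<Rightarrow> 'b) set) H. subsemigroup H (direct_power T I) \<and>
       S \<cong> (direct_power T I)\<lparr>carrier := H\<rparr>)"

lemma in_qvI:
  fixes S :: "('a, 'm) monoid_scheme" and T :: "('b, 'n) monoid_scheme" and J :: "'i set"
  assumes S: "semigroup_struct S" and H: "subsemigroup H (direct_power T J)"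
    and iso: "S \<cong> (direct_power T J)\<lparr>carrier := H\<rparr>"
  shows "in_qv T S"
proof -
  obtain h where h: "h \<in> Group.iso S ((direct_power T J)\<lparr>carrier := H\<rparr>)"
    using iso by (auto simp: is_iso_def)
  have hH: "h x \<in> H" if "x \<in> carrier S" for x
    using h that by (auto simp: iso_iff)
  have hE: "h x \<in> (\<Pi>\<^sub>E j\<in>J. carrier T)" if "x \<in> carrier S" for x
    using hH[OF that] H by (auto simp: subsemigroup_def direct_power_def)
  have hm: "h (x \<otimes>\<^bsub>S\<^esub> y) j = h x j \<otimes>\<^bsub>T\<^esub> h y j"
    if "x \<in> carrier S" "y \<in> carrier S" "j \<in> J" for x y j
  proof -
    have "h (x \<otimes>\<^bsub>S\<^esub> y) = h x \<otimes>\<^bsub>direct_power T J\<^esub> h y"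
      using h that(1,2) by (simp add: iso_iff hom_def)
    then show ?thesis using that(3) by (simp add: direct_power_def product_group_def)
  qed
  have hi: "inj_on h (carrier S)" using h by (auto simp: iso_iff)
  define I where "I = (\<lambda>j s. h s j) ` J"
  define g where "g = (\<lambda>s. \<lambda>f\<in>I. f s)"
  have gE: "g x \<in> (\<Pi>\<^sub>E i\<in>I. carrier T)" if "x \<in> carrier S" for x
    using hE[OF that] by (auto simp: g_def I_def)
  have gm: "g (x \<otimes>\<^bsub>S\<^esub> y) = g x \<otimes>\<^bsub>direct_power T I\<^esub> g y"
    if "x \<in> carrier S" "y \<in> carrier S" for x y
    unfolding g_def direct_power_def product_group_def monoid.simps
  proof (rule restrict_ext)
    fix f assume f: "f \<in> I"
    then obtain j where "j \<in> J" "f = (\<lambda>s. h s j)" unfolding I_def by blast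
    then show "f (x \<otimes>\<^bsub>S\<^esub> y) = (\<lambda>f\<in>I. f x) f \<otimes>\<^bsub>T\<^esub> (\<lambda>f\<in>I. f y) f"
      using hm[OF that] f by simp
  qed
  have gi: "inj_on g (carrier S)"
  proof (rule inj_onI)
    fix x y assume xy: "x \<in> carrier S" "y \<in> carrier S" "g x = g y"
    have "h x j = h y j" if "j \<in> J" for j
      using fun_cong[OF xy(3), of "\<lambda>s. h s j"] that by (auto simp: g_def I_def)
    then have "h x = h y" by (rule PiE_ext[OF hE[OF xy(1)] hE[OF xy(2)]])
    then show "x = y" using hi xy(1,2) by (auto dest: inj_onD)
  qed
  have sub: "subsemigroup (g ` carrier S) (direct_power T I)"
    unfolding subsemigroup_def
  proof (intro conjI ballI)
    show "g ` carrier S \<subseteq> carrier (direct_power T I)"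
      using gE by (auto simp: direct_power_def)
  next
    fix u v assume "u \<in> g ` carrier S" "v \<in> g ` carrier S"
    then obtain x y where xy: "x \<in> carrier S" "y \<in> carrier S" "u = g x" "v = g y" by blast
    then show "u \<otimes>\<^bsub>direct_power T I\<^esub> v \<in> g ` carrier S"
      using gm[OF xy(1,2)] semigroup_struct.mult_closed[OF S xy(1,2)] by (metis imageI)
  qed
  have "g \<in> Group.iso S ((direct_power T I)\<lparr>carrier := g ` carrier S\<rparr>)"
    using gm gi by (simp add: iso_iff hom_def)
  then show ?thesis
    using S sub unfolding in_qv_def by (blast intro: is_isoI)
qed

section \<open>Condition (CC')\<close>

text \<open>\<open>carrier S #> a\<close> is the principal left ideal \<open>Sa\<close>.\<close>

definition green_L :: "('a, 'm) monoid_scheme \<Rightarrow> 'a \<Rightarrow> 'a \<Rightarrow> bool" where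
  "green_L S a b \<longleftrightarrow> carrier S #>\<^bsub>S\<^esub> a = carrier S #>\<^bsub>S\<^esub> b"

definition lrb_le :: "('a, 'm) monoid_scheme \<Rightarrow> 'a \<Rightarrow> 'a \<Rightarrow> bool" where
  "lrb_le S x y \<longleftrightarrow> y \<otimes>\<^bsub>S\<^esub> x = x"

definition S'_poset :: "('a, 'm) monoid_scheme \<Rightarrow> 'a \<Rightarrow> 'a \<Rightarrow> 'a set" where
  "S'_poset S a b = {s \<in> carrier S. s \<otimes>\<^bsub>S\<^esub> a = s \<otimes>\<^bsub>S\<^esub> b \<and> a \<in> carrier S #>\<^bsub>S\<^esub> s}"

definition same_component :: "'a set \<Rightarrow> ('a \<Rightarrow> 'a \<Rightarrow> bool) \<Rightarrow> 'a \<Rightarrow> 'a \<Rightarrow> bool" where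
  "same_component P leq a b \<longleftrightarrow>
    a \<in> P \<and> b \<in> P \<and> equivclp (\<lambda>x y. x \<in> P \<and> y \<in> P \<and> leq x y) a b"

definition CC' :: "('a, 'm) monoid_scheme \<Rightarrow> bool" where
  "CC' S \<longleftrightarrow>
    (\<forall>a \<in> carrier S. \<forall>b \<in> carrier S.
       green_L S a b \<longrightarrow> same_component (S'_poset S a b) (lrb_le S) a b \<longrightarrow> a = b)"

end

theory Submission
  imports Defs
begin

text \<open>Membership in the quasivariety means that homomorphisms to \<open>ZL\<close> separate points. Elements
  that are not \<open>\<L>\<close>-equivalent are separated by a homomorphism to \<open>{0, z}\<close>. For distinct
  \<open>a \<L> b\<close> let \<open>F = {s. as = a}\<close>, which acts from the left on the \<open>\<L>\<close>-class \<open>X\<close> of \<open>a\<close>. A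
  homomorphism to \<open>ZL\<close> that is \<open>z\<close> exactly outside \<open>F\<close> and separates \<open>a\<close> from \<open>b\<close> amounts to a
  set \<open>A \<subseteq> X\<close> containing \<open>a\<close> but not \<open>b\<close> such that every \<open>s \<in> F\<close> maps \<open>X\<close> into \<open>A\<close>, or maps
  \<open>X\<close> into the complement of \<open>A\<close>, or preserves both \<open>A\<close> and its complement. Condition (CC'),
  applied to the pairs \<open>(sa, sb)\<close>, shows that an \<open>s \<in> F\<close> that moves \<open>a\<close> and \<open>b\<close> to the same
  component of \<open>S'\<^bsub>a,b\<^esub>\<close> moves all of \<open>X\<close> to that component. One then takes a maximal submonoid
  \<open>W\<close> of elements fixing the component of \<open>a\<close> and not moving \<open>b\<close> into it, and lets \<open>A\<close> be the
  set of all points that some \<open>w \<in> W\<close> moves to the component of \<open>a\<close>.\<close>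

section \<open>Separating homomorphisms\<close>

text \<open>The coordinates of an embedding into a direct power are homomorphisms to
  \<open>T\<close>. Conversely, if these separate points, evaluation embeds \<open>S\<close> into
  the power indexed by \<open>hom S T\<close>.\<close>

lemma in_qv_iff_hom_separates:
  fixes S :: "('a, 'm) monoid_scheme" and T :: "('b, 'n) monoid_scheme"
  assumes S: "semigroup_struct S"
  shows "in_qv T S \<longleftrightarrow>
    (\<forall>a \<in> carrier S. \<forall>b \<in> carrier S. (\<forall>h \<in> hom S T. h a = h b) \<longrightarrow> a = b)"
proof
  assume "in_qv T S"
  then obtain I :: "('a \<Rightarrow> 'b) set" and H g where H: "subsemigroup H (direct_power T I)"
    and g: "g \<in> iso S ((direct_power T I)\<lparr>carrier := H\<rparr>)"
    unfolding in_qv_def is_iso_def by blast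
  have gE: "g x \<in> (\<Pi>\<^sub>E i\<in>I. carrier T)" if "x \<in> carrier S" for x
    using g H that by (auto simp: iso_iff subsemigroup_def direct_power_def)
  have gm: "g (x \<otimes>\<^bsub>S\<^esub> y) i = g x i \<otimes>\<^bsub>T\<^esub> g y i"
    if "x \<in> carrier S" "y \<in> carrier S" "i \<in> I" for x y i
  proof -
    have "g (x \<otimes>\<^bsub>S\<^esub> y) = g x \<otimes>\<^bsub>direct_power T I\<^esub> g y"
      using g that(1,2) by (simp add: iso_iff hom_def)
    then show ?thesis using that(3) by (simp add: direct_power_def product_group_def)
  qed
  have hom: "(\<lambda>x. g x i) \<in> hom S T" if "i \<in> I" for i
    using gE gm that by (force simp: hom_def)
  show "\<forall>a \<in> carrier S. \<forall>b \<in> carrier S. (\<forall>h \<in> hom S T. h a = h b) \<longrightarrow> a = b"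
  proof (intro ballI impI)
    fix a b assume ab: "a \<in> carrier S" "b \<in> carrier S" and eq: "\<forall>h \<in> hom S T. h a = h b"
    have "g a = g b"
      using hom eq by (intro PiE_ext[OF gE[OF ab(1)] gE[OF ab(2)]]) (metis (no_types, lifting))
    then show "a = b" using g ab by (auto simp: iso_iff dest: inj_onD)
  qed
next
  assume sep: "\<forall>a \<in> carrier S. \<forall>b \<in> carrier S. (\<forall>h \<in> hom S T. h a = h b) \<longrightarrow> a = b"
  define g where "g = (\<lambda>x. \<lambda>h\<in>hom S T. h x)"
  have gE: "g x \<in> carrier (direct_power T (hom S T))" if "x \<in> carrier S" for x
    using that by (auto simp: g_def direct_power_def hom_def)
  have gm: "g (x \<otimes>\<^bsub>S\<^esub> y) = g x \<otimes>\<^bsub>direct_power T (hom S T)\<^esub> g y"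
    if "x \<in> carrier S" "y \<in> carrier S" for x y
    using that by (auto simp: g_def direct_power_def product_group_def hom_mult intro!: restrict_ext)
  have gi: "inj_on g (carrier S)"
  proof (rule inj_onI)
    fix x y assume xy: "x \<in> carrier S" "y \<in> carrier S" "g x = g y"
    have "h x = h y" if "h \<in> hom S T" for h
      using fun_cong[OF xy(3), of h] that by (simp add: g_def)
    then show "x = y" using sep xy by blast
  qed
  have sub: "subsemigroup (g ` carrier S) (direct_power T (hom S T))"
    unfolding subsemigroup_def
    using gE gm semigroup_struct.mult_closed[OF S] by (auto simp flip: gm)
  have "g \<in> iso S ((direct_power T (hom S T))\<lparr>carrier := g ` carrier S\<rparr>)"
    using gm gi by (simp add: iso_iff hom_def)
  then show "in_qv T S"
    using in_qvI[OF S sub] by (blast intro: is_isoI)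
qed

lemma carrier_ZL [simp]: "carrier ZL = UNIV"
  by (auto simp: ZL_def adjoin_zero_def L_monoid_def) (metis notin_range_Some)

lemma mult_ZL [simp]:
  "None \<otimes>\<^bsub>ZL\<^esub> y = None" "x \<otimes>\<^bsub>ZL\<^esub> None = None" "Some u \<otimes>\<^bsub>ZL\<^esub> Some v = Some (L_mult u v)"
  by (auto simp: ZL_def adjoin_zero_def L_monoid_def split: option.splits)

section \<open>Colouring a set acted on by a left regular band\<close>

text \<open>The function \<open>c\<close> assigns to each point its component; \<open>G\<close> acts on the components.\<close>

lemma left_regular_action_colouring:
  fixes G :: "('x \<Rightarrow> 'x) set" and c :: "'x \<Rightarrow> 'c"
  assumes G_id: "id \<in> G"
    and G_comp: "\<And>f g. f \<in> G \<Longrightarrow> g \<in> G \<Longrightarrow> f \<circ> g \<in> G"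
    and G_closed: "\<And>f x. f \<in> G \<Longrightarrow> x \<in> X \<Longrightarrow> f x \<in> X"
    and G_regular: "\<And>f g x. f \<in> G \<Longrightarrow> g \<in> G \<Longrightarrow> x \<in> X \<Longrightarrow> f (g (f x)) = f (g x)"
    and G_cong: "\<And>f x y. f \<in> G \<Longrightarrow> x \<in> X \<Longrightarrow> y \<in> X \<Longrightarrow> c x = c y \<Longrightarrow> c (f x) = c (f y)"
    and G_const: "\<And>f x. f \<in> G \<Longrightarrow> c (f a) = c (f b) \<Longrightarrow> x \<in> X \<Longrightarrow> c (f x) = c (f a)"
    and a: "a \<in> X" and b: "b \<in> X" and ab: "c a \<noteq> c b"
  shows "\<exists>A. a \<in> A \<and> b \<notin> A \<and>
    (\<forall>f \<in> G. (\<forall>x \<in> X. f x \<in> A) \<or> (\<forall>x \<in> X. f x \<notin> A) \<or> (\<forall>x \<in> X. f x \<in> A \<longleftrightarrow> x \<in> A))"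
proof -
  define good where "good W \<longleftrightarrow> W \<subseteq> G \<and> id \<in> W \<and> (\<forall>f \<in> W. \<forall>g \<in> W. f \<circ> g \<in> W) \<and>
    (\<forall>f \<in> W. c (f a) = c a \<and> c (f b) \<noteq> c a)" for W
  have "\<exists>W \<in> {W. good W}. \<forall>V \<in> {W. good W}. W \<subseteq> V \<longrightarrow> V = W"
  proof (rule subset_Zorn_nonempty)
    have "good {id}" using G_id ab by (auto simp: good_def)
    then show "{W. good W} \<noteq> {}" by blast
  next
    fix \<C> assume ne: "\<C> \<noteq> {}" and ch: "subset.chain {W. good W} \<C>"
    have good: "good W" if "W \<in> \<C>" for W
      using ch that by (auto simp: subset.chain_def)
    have "f \<circ> g \<in> \<Union>\<C>" if fg: "f \<in> \<Union>\<C>" "g \<in> \<Union>\<C>" for f g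
    proof -
      obtain V W where VW: "V \<in> \<C>" "W \<in> \<C>" "f \<in> V" "g \<in> W" using fg by blast
      then have "V \<subseteq> W \<or> W \<subseteq> V" using ch by (auto simp: subset_chain_def)
      then show ?thesis using VW good unfolding good_def by (metis UnionI subsetD)
    qed
    then have "good (\<Union>\<C>)" using good ne unfolding good_def by blast
    then show "\<Union>\<C> \<in> {W. good W}" by simp
  qed
  then obtain W where W: "good W" and max: "\<And>V. good V \<Longrightarrow> W \<subseteq> V \<Longrightarrow> V = W" by blast
  have WG: "f \<in> G" and Wa: "c (f a) = c a" and Wb: "c (f b) \<noteq> c a" if "f \<in> W" for f
    using W that by (auto simp: good_def)
  have Wid: "id \<in> W" and Wcomp: "\<And>f g. f \<in> W \<Longrightarrow> g \<in> W \<Longrightarrow> f \<circ> g \<in> W"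
    using W by (auto simp: good_def)
  \<comment> \<open>Maximality in usable form: \<open>t\<close> can be adjoined unless some
    \<open>y \<in> W\<close> carries \<open>t b\<close> into the component of \<open>a\<close>. Up
    to components, each \<open>u \<in> V\<close> is absorbed on the right of some
    \<open>y \<circ> t\<close>; left regularity gives this for \<open>u \<in> W\<close> with
    \<open>y = u\<close>, and for \<open>t\<close> with \<open>y = id\<close>.\<close>
  have absorb: "t \<in> W" if t: "t \<in> G" "c (t a) = c a" and tb: "\<And>y. y \<in> W \<Longrightarrow> c (y (t b)) \<noteq> c a" for t
  proof -
    text \<open>\<open>V\<close> contains the submonoid generated by \<open>W\<close> and \<open>t\<close>.\<close>
    define V where "V = {u \<in> G. c (u a) = c a \<and> (\<exists>y \<in> W. \<forall>x \<in> X. c (y (t (u x))) = c (y (t x)))}"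
    have "u \<circ> v \<in> V" if uv: "u \<in> V" "v \<in> V" for u v
    proof -
      obtain y z where y: "y \<in> W" "\<And>x. x \<in> X \<Longrightarrow> c (y (t (u x))) = c (y (t x))"
        and z: "z \<in> W" "\<And>x. x \<in> X \<Longrightarrow> c (z (t (v x))) = c (z (t x))"
        using uv by (auto simp: V_def)
      have uvG: "u \<in> G" "v \<in> G" using uv by (auto simp: V_def)
      note mem = G_closed WG[OF y(1)] WG[OF z(1)] t(1) uvG
      \<comment> \<open>This inserts \<open>y \<circ> t\<close> on the right of
        \<open>y \<circ> z \<circ> t\<close>, where it absorbs \<open>u\<close>; then
        \<open>z \<circ> t\<close> absorbs \<open>v\<close>, so \<open>y \<circ> z\<close> is a
        witness for \<open>u \<circ> v\<close>.\<close>
      have red: "y (z (t (y (t x)))) = y (z (t x))" if "x \<in> X" for x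
      proof -
        have "y (z (t (y (t x)))) = y (z (t (t x)))"
          using G_regular[of y "z \<circ> t" "t x"] G_comp mem that by simp
        also have "t (t x) = t x" using G_regular[of t id x] G_id t(1) that by simp
        finally show ?thesis .
      qed
      have "c (y (z (t (u (v x))))) = c (y (z (t x)))" if x: "x \<in> X" for x
      proof -
        have "c (y (z (t (u (v x))))) = c (y (z (t (y (t (u (v x)))))))"
          using red mem x by simp
        also have "\<dots> = c (y (z (t (y (t (v x))))))"
          using G_cong[of "y \<circ> (z \<circ> t)" "y (t (u (v x)))" "y (t (v x))"] y(2)[of "v x"]
            G_comp WG y(1) z(1) t(1) mem x by simp
        also have "\<dots> = c (y (z (t (v x))))" using red mem x by simp
        also have "\<dots> = c (y (z (t x)))"
          using G_cong[of y "z (t (v x))" "z (t x)"] z(2)[of x] WG y(1) mem x by simp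
        finally show ?thesis .
      qed
      moreover have "c (u (v a)) = c a"
        using G_cong[of u "v a" a] uv mem a by (auto simp: V_def)
      moreover have "y \<circ> z \<in> W" using Wcomp y z by blast
      ultimately show ?thesis
        unfolding V_def using G_comp uvG by (auto intro!: bexI[of _ "y \<circ> z"])
    qed
    moreover have "c (u b) \<noteq> c a" if u: "u \<in> V" for u
    proof
      assume ub: "c (u b) = c a"
      obtain y where y: "y \<in> W" "\<And>x. x \<in> X \<Longrightarrow> c (y (t (u x))) = c (y (t x))"
        using u by (auto simp: V_def)
      have yt: "y \<circ> t \<in> G" using G_comp WG y(1) t(1) by blast
      have "c (y (t b)) = c (y (t (u b)))" using y(2) b by simp
      also have "\<dots> = c (y (t a))"
        using G_cong[OF yt _ a ub] G_closed u b by (simp add: V_def)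
      also have "\<dots> = c (y a)" using G_cong[of y "t a" a] G_closed WG y(1) t a by simp
      also have "\<dots> = c a" using Wa y(1) by simp
      finally show False using tb y(1) by blast
    qed
    moreover have WV: "W \<subseteq> V"
    proof
      fix u assume u: "u \<in> W"
      then have "\<forall>x \<in> X. c (u (t (u x))) = c (u (t x))"
        using G_regular[OF WG[OF u] t(1)] by simp
      then show "u \<in> V" using u WG Wa by (auto simp: V_def)
    qed
    ultimately have "good V"
      using Wid unfolding good_def by (auto simp: V_def)
    then have "V = W" using max WV by blast
    moreover have "\<forall>x \<in> X. c (id (t (t x))) = c (id (t x))"
      using G_regular[of t id] G_id t(1) by simp
    then have "t \<in> V" using t Wid unfolding V_def by blast
    ultimately show ?thesis by simp
  qed
  define A where "A = {x. \<exists>w \<in> W. c (w x) = c a}"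
  \<comment> \<open>If no such \<open>p\<close> exists, the middle alternative of the goal
    holds.\<close>
  have "(\<forall>x \<in> X. f x \<in> A) \<or> (\<forall>x \<in> X. f x \<in> A \<longleftrightarrow> x \<in> A)"
    if f: "f \<in> G" and p: "p \<in> X" "f p \<in> A" for f p
  proof -
    obtain w where w: "w \<in> W" "c (w (f p)) = c a" using p by (auto simp: A_def)
    \<comment> \<open>This map sends \<open>p\<close> into the component of \<open>a\<close> and is
      idempotent on \<open>X\<close>, so it fixes that component.\<close>
    define t where "t = w \<circ> f"
    have t: "t \<in> G" using G_comp WG w f by (simp add: t_def)
    have "c (t a) = c (t (t p))"
      using G_cong[OF t G_closed[OF t p(1)] a] w by (simp add: t_def)
    also have "\<dots> = c a" using G_regular[of t id p] G_id t p w by (simp add: t_def)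
    finally have ta: "c (t a) = c a" .
    show ?thesis
    \<comment> \<open>Either some \<open>y \<circ> t\<close> moves both \<open>a\<close> and
      \<open>b\<close> into the component of \<open>a\<close>, and by \<open>G_const\<close> all of
      \<open>X\<close> follows, or \<open>absorb\<close> puts \<open>t\<close> into
      \<open>W\<close>.\<close>
    proof (cases "\<exists>y \<in> W. c (y (t b)) = c a")
      case True
      then obtain y where y: "y \<in> W" "c (y (t b)) = c a" by blast
      have yt: "y \<circ> t \<in> G" using G_comp WG y t by blast
      have "c (y (t a)) = c (y a)" using G_cong[OF WG _ a ta] y(1) G_closed t a by blast
      then have yta: "c (y (t a)) = c a" using Wa y by simp
      have "c ((y \<circ> w) (f x)) = c a" if "x \<in> X" for x
        using G_const[OF yt _ that] y yta by (simp add: t_def)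
      then show ?thesis using Wcomp y w unfolding A_def by blast
    next
      case False
      then have tW: "t \<in> W" using absorb t ta by blast
      have "f x \<in> A \<longleftrightarrow> x \<in> A" if x: "x \<in> X" for x
      proof
        assume "f x \<in> A"
        then obtain v where v: "v \<in> W" "c (v (f x)) = c a" by (auto simp: A_def)
        have "c (w (v (t x))) = c (w (v (f x)))"
          using G_regular[of w v "f x"] WG v w G_closed f x by (simp add: t_def)
        also have "\<dots> = c (w a)" using G_cong[of w "v (f x)" a] WG v w G_closed f x a by simp
        also have "\<dots> = c a" using Wa w by simp
        finally have "c ((w \<circ> (v \<circ> t)) x) = c a" by simp
        then show "x \<in> A" using Wcomp w v tW unfolding A_def by blast
      next
        assume "x \<in> A"
        then obtain v where v: "v \<in> W" "c (v x) = c a" by (auto simp: A_def)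
        have "c (v (t x)) = c (v (t (v x)))" using G_regular[OF WG[OF v(1)] t x] by simp
        also have "\<dots> = c (v (t a))"
          using G_cong[of "v \<circ> t" "v x" a] G_comp WG v t G_closed x a by simp
        also have "\<dots> = c a" using Wa[of "v \<circ> t"] Wcomp v tW by simp
        finally have "c ((v \<circ> w) (f x)) = c a" by (simp add: t_def)
        then show "f x \<in> A" using Wcomp v w unfolding A_def by blast
      qed
      then show ?thesis by blast
    qed
  qed
  moreover have "a \<in> A" using Wid Wa by (auto simp: A_def)
  moreover have "b \<notin> A" using Wb by (auto simp: A_def)
  ultimately show ?thesis by (intro exI[of _ A]) blast
qed

section \<open>Left regular bands\<close>

lemma equivclp_image:
  assumes "equivclp R x y" and "\<And>x y. R x y \<Longrightarrow> Q (f x) (f y)"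
  shows "equivclp Q (f x) (f y)"
  using assms(1)
proof (induction rule: equivclp_induct)
  case (step y z)
  then show ?case using assms(2) equivclp_into_equivclp[of Q "f x" "f y" "f z"] by blast
qed simp

context left_regular_band
begin

section \<open>Principal left ideals and right stabilizers\<close>

lemma mem_principal_iff: "\<lbrakk>a \<in> carrier S; s \<in> carrier S\<rbrakk> \<Longrightarrow> a \<in> carrier S #> s \<longleftrightarrow> a \<otimes> s = a"
  unfolding r_coset_def using mult_assoc idem by auto metis

lemma green_L_iff:
  assumes a: "a \<in> carrier S" and b: "b \<in> carrier S"
  shows "green_L S a b \<longleftrightarrow> a \<otimes> b = a \<and> b \<otimes> a = b"
proof
  assume "green_L S a b"
  moreover have "a \<in> carrier S #> a" "b \<in> carrier S #> b" using a b idem mem_principal_iff by auto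
  ultimately show "a \<otimes> b = a \<and> b \<otimes> a = b"
    using mem_principal_iff a b unfolding green_L_def by blast
next
  assume ab: "a \<otimes> b = a \<and> b \<otimes> a = b"
  have "x \<otimes> a = x \<longleftrightarrow> x \<otimes> b = x" if "x \<in> carrier S" for x
    using ab a b that mult_assoc by metis
  moreover have "carrier S #> a \<subseteq> carrier S" "carrier S #> b \<subseteq> carrier S"
    using a b mult_closed by (auto simp: r_coset_def)
  ultimately show "green_L S a b"
    unfolding green_L_def using mem_principal_iff a b by blast
qed

lemma S'_poset_iff:
  "a \<in> carrier S \<Longrightarrow> s \<in> S'_poset S a b \<longleftrightarrow> s \<in> carrier S \<and> s \<otimes> a = s \<otimes> b \<and> a \<otimes> s = a"
  using mem_principal_iff by (auto simp: S'_poset_def)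

text \<open>If \<open>a s t = a\<close>, then \<open>a s = a s t s = a s t = a\<close>. The
  stabilizer is thus closed under products and its complement is an ideal, which can be sent to the
  zero of \<open>ZL\<close>.\<close>

lemma right_stabilizer_mult_iff:
  assumes "a \<in> carrier S" "s \<in> carrier S" "t \<in> carrier S"
  shows "a \<otimes> (s \<otimes> t) = a \<longleftrightarrow> a \<otimes> s = a \<and> a \<otimes> t = a"
proof
  assume *: "a \<otimes> (s \<otimes> t) = a"
  have "a \<otimes> s = a \<otimes> (s \<otimes> t \<otimes> s)" using * assms mult_assoc mult_closed by metis
  moreover have "a \<otimes> t = a \<otimes> (s \<otimes> (t \<otimes> t))" using * assms mult_assoc mult_closed by metis
  ultimately show "a \<otimes> s = a \<and> a \<otimes> t = a" using * assms left_regular idem by simp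
qed (use assms mult_assoc in metis)

section \<open>Homomorphisms to \<open>ZL\<close>\<close>

text \<open>The value at \<open>a\<close> is \<open>Some L_id\<close>, so agreement at
  \<open>b\<close> forces \<open>a \<otimes> b = a\<close>. With the roles exchanged, such maps
  separate elements with different principal left ideals.\<close>

lemma hom_ZL_stabilizer:
  assumes a: "a \<in> carrier S"
  shows "(\<lambda>s. if a \<otimes> s = a then Some L_id else None) \<in> hom S ZL"
  using right_stabilizer_mult_iff[OF a] by (auto simp: hom_def)

text \<open>If \<open>s\<close> sends all of \<open>X\<close> to one side of \<open>A\<close>, so
  does \<open>s \<otimes> t\<close>, as \<open>t\<close> maps \<open>X\<close> to itself. Otherwise
  \<open>s\<close> preserves both sides, and \<open>s \<otimes> t\<close> behaves like
  \<open>t\<close>.\<close>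

lemma hom_ZL_colouring:
  assumes a: "a \<in> carrier S" and X: "X = {m \<in> carrier S. m \<otimes> a = m \<and> a \<otimes> m = a}"
    and col: "\<And>s. s \<in> carrier S \<Longrightarrow> a \<otimes> s = a \<Longrightarrow>
      (\<forall>x \<in> X. s \<otimes> x \<in> A) \<or> (\<forall>x \<in> X. s \<otimes> x \<notin> A) \<or> (\<forall>x \<in> X. s \<otimes> x \<in> A \<longleftrightarrow> x \<in> A)"
  shows "(\<lambda>s. if a \<otimes> s = a then
      Some (if \<forall>x \<in> X. s \<otimes> x \<in> A then L_plus else if \<forall>x \<in> X. s \<otimes> x \<notin> A then L_minus else L_id)
    else None) \<in> hom S ZL" (is "?h \<in> _")
proof -
  have aX: "a \<in> X" using a idem by (simp add: X)
  have "?h (s \<otimes> t) = ?h s \<otimes>\<^bsub>ZL\<^esub> ?h t" if st: "s \<in> carrier S" "t \<in> carrier S" for s t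
  proof (cases "a \<otimes> s = a \<and> a \<otimes> t = a")
    case True
    have st_x: "(s \<otimes> t) \<otimes> x = s \<otimes> (t \<otimes> x)" if "x \<in> X" for x
      using that st mult_assoc by (simp add: X)
    have tX: "t \<otimes> x \<in> X" if "x \<in> X" for x
      using that st True a mult_closed mult_assoc right_stabilizer_mult_iff by (auto simp: X)
    have stab: "a \<otimes> (s \<otimes> t) = a" using True right_stabilizer_mult_iff[OF a st] by simp
    consider "\<forall>x \<in> X. s \<otimes> x \<in> A" | "\<forall>x \<in> X. s \<otimes> x \<notin> A"
      | "\<not> (\<forall>x \<in> X. s \<otimes> x \<in> A)" "\<not> (\<forall>x \<in> X. s \<otimes> x \<notin> A)" "\<forall>x \<in> X. s \<otimes> x \<in> A \<longleftrightarrow> x \<in> A"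
      using col[of s] st True by blast
    then show ?thesis
    proof cases
      case 1
      then show ?thesis using True stab st_x tX by simp
    next
      case 2
      \<comment> \<open>Since \<open>X\<close> is nonempty, landing in \<open>A\<close> and landing
        outside \<open>A\<close> exclude each other.\<close>
      then have "\<not> (\<forall>x \<in> X. s \<otimes> x \<in> A)" "\<not> (\<forall>x \<in> X. s \<otimes> (t \<otimes> x) \<in> A)"
        using aX tX by blast+
      then show ?thesis using 2 True stab st_x tX by simp
    next
      case 3
      then have "(\<forall>x \<in> X. s \<otimes> (t \<otimes> x) \<in> A) \<longleftrightarrow> (\<forall>x \<in> X. t \<otimes> x \<in> A)"
        "(\<forall>x \<in> X. s \<otimes> (t \<otimes> x) \<notin> A) \<longleftrightarrow> (\<forall>x \<in> X. t \<otimes> x \<notin> A)"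
        using tX by blast+
      moreover have "?h s = Some L_id" using 3(1,2) True by simp
      ultimately show ?thesis using True stab st_x by (simp split del: if_split cong: if_cong)
    qed
  next
    case False
    then show ?thesis using right_stabilizer_mult_iff[OF a st] by auto
  qed
  then show ?thesis by (simp add: hom_def)
qed

text \<open>If \<open>h a\<close> and \<open>h b\<close> differ, they are the two left zeroes of
  \<open>L\<close>. For \<open>s\<close> in the poset, \<open>s a = s b\<close> rules out the
  identity as value of \<open>h\<close> and \<open>a s = a\<close> rules out the zero. On the left
  zeroes the order is equality, so \<open>h\<close> is constant along a zig-zag.\<close>

lemma hom_ZL_eq_on_component:
  assumes h: "h \<in> hom S ZL" and a: "a \<in> carrier S" and b: "b \<in> carrier S"
    and L: "green_L S a b" and comp: "same_component (S'_poset S a b) (lrb_le S) a b"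
  shows "h a = h b"
proof (rule ccontr)
  assume ne: "h a \<noteq> h b"
  have ab: "h a \<otimes>\<^bsub>ZL\<^esub> h b = h a" "h b \<otimes>\<^bsub>ZL\<^esub> h a = h b"
    using L a b h green_L_iff by (metis hom_mult)+
  then obtain u v where uv: "h a = Some u" "h b = Some v" "u \<noteq> v" "u \<noteq> L_id" "v \<noteq> L_id"
    using ne by (cases "h a"; cases "h b") (auto elim: L_mult.elims)
  have left_zero: "\<exists>w. h s = Some w \<and> w \<noteq> L_id" if "s \<in> S'_poset S a b" for s
  proof -
    have s: "s \<in> carrier S" "s \<otimes> a = s \<otimes> b" "a \<otimes> s = a" using that S'_poset_iff[OF a] by auto
    have "h s \<otimes>\<^bsub>ZL\<^esub> h a = h s \<otimes>\<^bsub>ZL\<^esub> h b" "h a \<otimes>\<^bsub>ZL\<^esub> h s = h a"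
      using s a b h by (metis hom_mult)+
    then show ?thesis using uv by (cases "h s") auto
  qed
  have step: "h x = h y" if xy: "x \<in> S'_poset S a b" "y \<in> S'_poset S a b" "lrb_le S x y" for x y
  proof -
    have "x \<in> carrier S" "y \<in> carrier S" using xy S'_poset_iff[OF a] by auto
    then have "h y \<otimes>\<^bsub>ZL\<^esub> h x = h x" using xy(3) h unfolding lrb_le_def by (metis hom_mult)
    moreover obtain w w' where "h x = Some w" "h y = Some w'" "w' \<noteq> L_id"
      using left_zero[OF xy(1)] left_zero[OF xy(2)] by blast
    ultimately show ?thesis by (cases w') auto
  qed
  have "equivclp (\<lambda>x y. x \<in> S'_poset S a b \<and> y \<in> S'_poset S a b \<and> lrb_le S x y) a b"
    using comp by (simp add: same_component_def)
  then have "h a = h b"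
    by (induction rule: equivclp_induct) (use step in \<open>metis+\<close>)
  then show False using ne by simp
qed

text \<open>The colouring lemma is applied to \<open>F\<close> acting on \<open>X\<close> by left
  multiplication. Maps that are the identity on \<open>X\<close> are added to \<open>G\<close>
  because no element of \<open>F\<close> need act in this way.\<close>

lemma hom_ZL_separates:
  assumes CC: "CC' S" and a: "a \<in> carrier S" and b: "b \<in> carrier S" and ne: "a \<noteq> b"
    and ab: "a \<otimes> b = a" and ba: "b \<otimes> a = b"
  shows "\<exists>h \<in> hom S ZL. h a \<noteq> h b"
proof -
  define P where "P = S'_poset S a b"
  define R where "R = (\<lambda>x y. x \<in> P \<and> y \<in> P \<and> lrb_le S x y)"
  define X where "X = {m \<in> carrier S. m \<otimes> a = m \<and> a \<otimes> m = a}"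
  define F where "F = {s \<in> carrier S. a \<otimes> s = a}"
  define c where "c = (\<lambda>x. {y. equivclp R x y})"
  text \<open>Maps are only compared on \<open>X\<close>, since associativity fails outside the carrier.\<close>
  define G where "G = {f. (\<forall>x \<in> X. f x = x) \<or> (\<exists>s \<in> F. \<forall>x \<in> X. f x = s \<otimes> x)}"
  have P_iff: "s \<in> P \<longleftrightarrow> s \<in> F \<and> s \<otimes> a = s \<otimes> b" for s
    using S'_poset_iff[OF a] by (auto simp: P_def F_def)
  have F_mult: "s \<otimes> t \<in> F" if "s \<in> F" "t \<in> F" for s t
    using that right_stabilizer_mult_iff[OF a] mult_closed by (simp add: F_def)
  have F_carrier: "s \<in> carrier S" if "s \<in> F" for s using that by (simp add: F_def)
  have XF: "X \<subseteq> F" by (auto simp: X_def F_def)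
  have FX: "s \<otimes> x \<in> X" if "s \<in> F" "x \<in> X" for s x
  proof -
    have x: "x \<in> carrier S" "x \<otimes> a = x" "x \<in> F" using that XF by (auto simp: X_def)
    then have "s \<otimes> x \<otimes> a = s \<otimes> x" using that(1) a mult_assoc F_carrier by simp
    then show ?thesis using F_mult[OF that(1) x(3)] by (simp add: X_def F_def)
  qed
  have aX: "a \<in> X" and bX: "b \<in> X" using a b ab ba idem by (auto simp: X_def)
  have reg: "s \<otimes> (t \<otimes> (s \<otimes> x)) = s \<otimes> (t \<otimes> x)"
    if "s \<in> carrier S" "t \<in> carrier S" "x \<in> carrier S" for s t x
    using that left_regular[of s t] by (simp add: mult_closed flip: mult_assoc)
  \<comment> \<open>With \<open>FP\<close>, this makes \<open>P\<close> an ideal of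
    \<open>F\<close>: left regularity gives
    \<open>s t a = s t s a = s t s b = s t b\<close>.\<close>
  have PF: "s \<otimes> t \<in> P" if "s \<in> P" "t \<in> F" for s t
  proof -
    have s: "s \<in> F" "s \<otimes> a = s \<otimes> b" using that P_iff by auto
    have "s \<otimes> (t \<otimes> a) = s \<otimes> (t \<otimes> b)"
      using reg[of s t a] reg[of s t b] s F_carrier that(2) a b by metis
    then show ?thesis using P_iff s F_mult F_carrier that(2) mult_assoc a b by simp
  qed
  have FP: "s \<otimes> t \<in> P" if "s \<in> F" "t \<in> P" for s t
    using that F_mult P_iff F_carrier mult_assoc a b by simp
  have c_eq: "c x = c y \<longleftrightarrow> equivclp R x y" for x y
    unfolding c_def by (auto intro: equivclp_trans equivclp_sym)
  have R_mult: "R (s \<otimes> x) (s \<otimes> y)" if "s \<in> F" "R x y" for s x y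
  proof -
    have "x \<in> carrier S" "y \<in> carrier S" "y \<otimes> x = x" using that P_iff F_carrier
      by (auto simp: R_def lrb_le_def)
    then have "(s \<otimes> y) \<otimes> (s \<otimes> x) = s \<otimes> x"
      using reg[of s y x] F_carrier[OF that(1)] mult_assoc mult_closed by simp
    then show ?thesis using that FP by (simp add: R_def lrb_le_def)
  qed
  have c_mult: "c (s \<otimes> x) = c (s \<otimes> y)" if "s \<in> F" "c x = c y" for s x y
  proof -
    have "equivclp R (s \<otimes> x) (s \<otimes> y)"
      using that c_eq R_mult by (intro equivclp_image[of R x y R "\<lambda>x. s \<otimes> x"]) auto
    then show ?thesis using c_eq by simp
  qed
  \<comment> \<open>The inclusion \<open>sub\<close> turns a zig-zag in \<open>P\<close> into one in
    the poset of the pair \<open>x\<close>, \<open>y\<close>, to which (CC') then applies.\<close>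
  have comp_eq: "x = y" if x: "x \<in> X" and y: "y \<in> X" and "c x = c y"
    and sub: "P \<subseteq> S'_poset S x y" for x y
  proof -
    have xy: "x \<in> carrier S" "y \<in> carrier S" using x y by (auto simp: X_def)
    have "x \<otimes> y = x" "y \<otimes> x = y" using x y a mult_assoc unfolding X_def
      by (metis (mono_tags, lifting) mem_Collect_eq)+
    then have "green_L S x y" and "x \<in> S'_poset S x y" "y \<in> S'_poset S x y"
      using green_L_iff S'_poset_iff xy idem by auto
    moreover have "equivclp R x y" using \<open>c x = c y\<close> c_eq by simp
    then have "equivclp (\<lambda>u v. u \<in> S'_poset S x y \<and> v \<in> S'_poset S x y \<and> lrb_le S u v) x y"
      by (rule equivclp_image[where f = "\<lambda>x. x"]) (use sub in \<open>auto simp: R_def\<close>)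
    ultimately show ?thesis using CC xy by (simp add: CC'_def same_component_def)
  qed
  have ca_cb: "c a \<noteq> c b" using comp_eq[OF aX bX] ne by (auto simp: P_def)
  \<comment> \<open>By \<open>comp_eq\<close>, \<open>s a = s b\<close>, so \<open>s\<close> itself
    lies in \<open>P\<close>; every \<open>s \<otimes> y\<close> lies below \<open>s\<close> in
    \<open>P\<close> and hence in its component.\<close>
  have const: "c (s \<otimes> x) = c (s \<otimes> a)" if s: "s \<in> F" and eq: "c (s \<otimes> a) = c (s \<otimes> b)" and x: "x \<in> X"
    for s x
  proof -
    have "P \<subseteq> S'_poset S (s \<otimes> a) (s \<otimes> b)"
    proof
      fix t assume t: "t \<in> P"
      then have tF: "t \<in> F" using P_iff by blast
      have "t \<otimes> (s \<otimes> a) = t \<otimes> (s \<otimes> b)"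
        using PF[OF t s] P_iff F_carrier tF s mult_assoc a b by simp
      moreover have "s \<otimes> a \<otimes> t = s \<otimes> a" using tF s a mult_assoc by (simp add: F_def)
      ultimately show "t \<in> S'_poset S (s \<otimes> a) (s \<otimes> b)"
        using S'_poset_iff mult_closed F_carrier s tF a by simp
    qed
    then have "s \<otimes> a = s \<otimes> b" using comp_eq FX s aX bX eq by blast
    then have sP: "s \<in> P" using P_iff s by simp
    have "c (s \<otimes> y) = c s" if "y \<in> X" for y
    proof -
      have "s \<otimes> (s \<otimes> y) = s \<otimes> y"
        using idem mult_assoc F_carrier s XF that by (metis subsetD)
      then have "R (s \<otimes> y) s" using PF sP XF that by (auto simp: R_def lrb_le_def)
      then show ?thesis using c_eq by (simp add: r_into_equivclp)
    qed
    then show ?thesis using x aX by simp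
  qed
  have XC: "x \<in> carrier S" if "x \<in> X" for x using that by (simp add: X_def)
  have "\<exists>A. a \<in> A \<and> b \<notin> A \<and>
    (\<forall>f \<in> G. (\<forall>x \<in> X. f x \<in> A) \<or> (\<forall>x \<in> X. f x \<notin> A) \<or> (\<forall>x \<in> X. f x \<in> A \<longleftrightarrow> x \<in> A))"
  proof (rule left_regular_action_colouring[where c = c])
    show "id \<in> G" by (simp add: G_def)
  next
    fix f g assume f: "f \<in> G" and g: "g \<in> G"
    have gX: "g x \<in> X" if "x \<in> X" for x using g FX that by (auto simp: G_def)
    consider "\<forall>x \<in> X. f x = x" | "\<forall>x \<in> X. g x = x"
      | s t where "s \<in> F" "t \<in> F" "\<forall>x \<in> X. f x = s \<otimes> x" "\<forall>x \<in> X. g x = t \<otimes> x"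
      using f g by (auto simp: G_def)
    then show "f \<circ> g \<in> G"
    proof cases
      case 3
      then have "\<forall>x \<in> X. (f \<circ> g) x = (s \<otimes> t) \<otimes> x"
        using gX mult_assoc F_carrier XC by simp
      then show ?thesis using F_mult 3 unfolding G_def by blast
    qed (use f g gX in \<open>auto simp: G_def\<close>)
  next
    fix f x assume "f \<in> G" "x \<in> X"
    then show "f x \<in> X" using FX by (auto simp: G_def)
  next
    fix f g x assume f: "f \<in> G" and g: "g \<in> G" and x: "x \<in> X"
    show "f (g (f x)) = f (g x)"
    proof (cases "\<forall>x \<in> X. f x = x")
      case False
      then obtain s where s: "s \<in> F" "\<And>x. x \<in> X \<Longrightarrow> f x = s \<otimes> x" using f by (auto simp: G_def)
      have ss: "s \<otimes> (s \<otimes> x) = s \<otimes> x"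
        using idem F_carrier[OF s(1)] XC[OF x] by (simp flip: mult_assoc)
      have sx: "s \<otimes> x \<in> X" using FX s(1) x by blast
      consider "\<forall>x \<in> X. g x = x" | t where "t \<in> F" "\<And>x. x \<in> X \<Longrightarrow> g x = t \<otimes> x"
        using g by (auto simp: G_def)
      then show ?thesis
      proof cases
        case 1
        then show ?thesis using ss s(2)[OF x] s(2)[OF sx] x sx by simp
      next
        case (2 t)
        have "s \<otimes> (t \<otimes> (s \<otimes> x)) = s \<otimes> (t \<otimes> x)"
          using reg[OF F_carrier F_carrier XC] s(1) 2(1) x by blast
        then show ?thesis
          using s(2)[OF x] 2(2)[OF x] 2(2)[OF sx] s(2)[OF FX[OF 2(1) x]] s(2)[OF FX[OF 2(1) sx]]
          by simp
      qed
    qed (use x in simp)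
  next
    fix f x y assume f: "f \<in> G" and xy: "x \<in> X" "y \<in> X" "c x = c y"
    show "c (f x) = c (f y)"
    proof (cases "\<forall>x \<in> X. f x = x")
      case False
      then obtain s where "s \<in> F" "\<And>x. x \<in> X \<Longrightarrow> f x = s \<otimes> x" using f by (auto simp: G_def)
      then show ?thesis using c_mult[of s x y] xy by simp
    qed (use xy in simp)
  next
    fix f x assume f: "f \<in> G" "c (f a) = c (f b)" and x: "x \<in> X"
    \<comment> \<open>The identity on \<open>X\<close> is excluded here because
      \<open>c a \<noteq> c b\<close>.\<close>
    then obtain s where "s \<in> F" "\<And>x. x \<in> X \<Longrightarrow> f x = s \<otimes> x"
      using ca_cb aX bX by (auto simp: G_def)
    then show "c (f x) = c (f a)" using const[of s x] f(2) x aX bX by simp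
  qed (use aX bX ca_cb in auto)
  then obtain A where A: "a \<in> A" "b \<notin> A" and G_A: "\<forall>f \<in> G. (\<forall>x \<in> X. f x \<in> A) \<or> (\<forall>x \<in> X. f x \<notin> A) \<or>
    (\<forall>x \<in> X. f x \<in> A \<longleftrightarrow> x \<in> A)" by blast
  have "(\<forall>x \<in> X. s \<otimes> x \<in> A) \<or> (\<forall>x \<in> X. s \<otimes> x \<notin> A) \<or> (\<forall>x \<in> X. s \<otimes> x \<in> A \<longleftrightarrow> x \<in> A)"
    if "s \<in> carrier S" "a \<otimes> s = a" for s
  proof -
    have "(\<lambda>x. s \<otimes> x) \<in> G" using that by (auto simp: G_def F_def)
    then show ?thesis using G_A by fast
  qed
  note h = hom_ZL_colouring[OF a X_def this]
  \<comment> \<open>Both elements act on \<open>X\<close> as constants, so \<open>a\<close> gets the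
    value \<open>L_plus\<close> and \<open>b\<close> the value \<open>L_minus\<close>.\<close>
  have "a \<otimes> x = a" "b \<otimes> x = b" if "x \<in> X" for x
    using that ab ba a b mult_assoc unfolding X_def by auto metis
  then have "\<forall>x \<in> X. a \<otimes> x \<in> A" "\<not> (\<forall>x \<in> X. b \<otimes> x \<in> A)" "\<forall>x \<in> X. b \<otimes> x \<notin> A"
    using A aX by auto
  then show ?thesis by (intro bexI[OF _ h]) (use ab idem[OF a] in simp)
qed

end

theorem theorem8:
  fixes S :: "('a, 'm) monoid_scheme"
  assumes "left_regular_band S"
  shows "in_qv ZL S \<longleftrightarrow> CC' S"
proof -
  interpret left_regular_band S by fact
  have "in_qv ZL S \<longleftrightarrow>
    (\<forall>a \<in> carrier S. \<forall>b \<in> carrier S. (\<forall>h \<in> hom S ZL. h a = h b) \<longrightarrow> a = b)"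
    by (rule in_qv_iff_hom_separates) (rule semigroup_struct_axioms)
  also have "\<dots> \<longleftrightarrow> CC' S"
  proof
    assume "\<forall>a \<in> carrier S. \<forall>b \<in> carrier S. (\<forall>h \<in> hom S ZL. h a = h b) \<longrightarrow> a = b"
    then show "CC' S" unfolding CC'_def using hom_ZL_eq_on_component by meson
  next
    assume CC: "CC' S"
    show "\<forall>a \<in> carrier S. \<forall>b \<in> carrier S. (\<forall>h \<in> hom S ZL. h a = h b) \<longrightarrow> a = b"
    proof (intro ballI impI)
      fix a b assume a: "a \<in> carrier S" and b: "b \<in> carrier S" and eq: "\<forall>h \<in> hom S ZL. h a = h b"
      have "a \<otimes>\<^bsub>S\<^esub> b = a" using bspec[OF eq hom_ZL_stabilizer[OF a]] idem[OF a] by (auto split: if_splits)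
      moreover have "b \<otimes>\<^bsub>S\<^esub> a = b"
        using bspec[OF eq hom_ZL_stabilizer[OF b]] idem[OF b] by (auto split: if_splits)
      ultimately show "a = b" using hom_ZL_separates[OF CC a b] eq by blast
    qed
  qed
  finally show ?thesis .
qed

end
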